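(* If $d$ is odd then $\mathcal{C}_d(d-1,d)=\{n^2 : n\in\mathbb{Z}^+\}$.
   Context: Orthogonality and the norm refer to the standard Euclidean inner product. $\mathbb{Z}^+$ is the set of positive integers. For positive integers $d,N,n$, $\mathcal{O}_d(N,n)$ denotes the collection of sets $\mathcal{S}\subset\mathbb{Z}^d$ of (pairwise) orthogonal vectors of norm $\sqrt{N}$ with $\#\mathcal{S}=n$. For $1\le n_1<n_2\le d$, \[ \mathcal{C}_d(n_1,n_2)=\big\{N\in\mathbb{Z}^+ : \forall\, \mathcal{S}\in\mathcal{O}_d(N,n_1)\ \exists\, \mathcal{S}'\in\mathcal{O}_d(N,n_2)\text{ with }\mathcal{S}'\supset\mathcal{S}\big\}. \] The symbol $\supset$ denotes inclusion.
   Formalization: The equality fails for d ≡ 3 mod 4 (for d=3, N=3, O_3(3,2) is empty, so 3 lies in C_3(2,3) vacuously). Proved: for odd d ≥ 3, the N in C_d(d-1,d) with O_d(N,d-1) nonempty are exactly the positive squares; for d ≡ 1 mod 4 the equality holds as stated. *)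

theory Defs
  imports Complex_Main "Jordan_Normal_Form.Matrix"
begin

text \<open>The standard Euclidean norm of an integer vector.\<close>

definition enorm :: "int vec \<Rightarrow> real" where
  "enorm v = sqrt (real_of_int (v \<bullet> v))"

text \<open>\<open>orth_sets d N n\<close> is $\mathcal{O}_d(N,n)$ and \<open>ext_set d n1 n2\<close> is $\mathcal{C}_d(n_1,n_2)$.\<close>

definition orth_sets :: "nat \<Rightarrow> nat \<Rightarrow> nat \<Rightarrow> int vec set set" where
  "orth_sets d N n =
     {S. S \<subseteq> carrier_vec d \<and> finite S \<and> card S = n \<and>
         pairwise (\<lambda>v w. v \<bullet> w = 0) S \<and> (\<forall>v\<in>S. enorm v = sqrt (real N))}"

definition ext_set :: "nat \<Rightarrow> nat \<Rightarrow> nat \<Rightarrow> nat set" where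
  "ext_set d n1 n2 =
     {N. 0 < N \<and> (\<forall>S\<in>orth_sets d N n1. \<exists>S'\<in>orth_sets d N n2. S \<subseteq> S')}"

text \<open>
  Membership in \<open>ext_set d n1 n2\<close> holds vacuously when \<open>orth_sets d N n1\<close> is empty.
  For \<open>n1 = d - 1\<close> and \<open>d mod 4 = 3\<close> this does happen, for every \<open>N\<close> that is not a sum of
  two squares, and such an \<open>N\<close> is not a square. The lemmas below are the smallest instance: they show
  that \<open>ext_set d (d - 1) d = {n\<^sup>2 | n. 0 < n}\<close> fails for \<open>d = 3\<close>.
  If \<open>d mod 4 = 1\<close>, then \<open>orth_sets d N (d - 1)\<close> is nonempty for all \<open>N > 0\<close>: write \<open>N\<close>
  as a sum of four squares and use diagonal blocks of \<open>4 \<times> 4\<close> quaternion matrices.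
\<close>

lemma orth_sets_3_3_2_empty: "orth_sets 3 3 2 = {}"
proof -
  have False if S: "S \<in> orth_sets 3 3 2" for S
  proof -
    from S have "card S = 2" by (simp add: orth_sets_def)
    then obtain v w where vw: "S = {v, w}" "v \<noteq> w" by (auto simp: card_2_iff)
    have dim: "dim_vec v = 3" "dim_vec w = 3" and orth: "v \<bullet> w = 0"
      and "enorm v = sqrt (real 3)" "enorm w = sqrt (real 3)"
      using S vw by (auto simp: orth_sets_def pairwise_def)
    then have nrm: "v \<bullet> v = 3" "w \<bullet> w = 3" by (simp_all add: enorm_def)
    have sp: "a \<bullet> b = a $ 0 * b $ 0 + a $ 1 * b $ 1 + a $ 2 * b $ 2"
      if "dim_vec b = 3" for a b :: "int vec"
      using that by (simp add: scalar_prod_def numeral_3_eq_3 numeral_2_eq_2)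
    have odd_if: "odd x \<and> odd y \<and> odd z" if "x * x + y * y + z * z = 3" for x y z :: int
    proof -
      have sq: "even t \<and> t * t mod 4 = 0 \<or> odd t \<and> t * t mod 4 = 1" for t :: int
      proof (cases "even t")
        case True
        then obtain k where "t = 2 * k" ..
        then show ?thesis by simp
      next
        case False
        then obtain k where "t = 2 * k + 1" by (rule oddE)
        then have "t * t = 1 + 4 * (k * k + k)" by (simp add: algebra_simps)
        then show ?thesis using False by presburger
      qed
      show ?thesis using sq[of x] sq[of y] sq[of z] that by presburger
    qed
    have "odd (v $ 0 * w $ 0 + v $ 1 * w $ 1 + v $ 2 * w $ 2)"
      using odd_if[of "v $ 0" "v $ 1" "v $ 2"] odd_if[of "w $ 0" "w $ 1" "w $ 2"] nrm dim
      by (simp add: sp)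
    with orth dim show False by (simp add: sp)
  qed
  then show ?thesis by blast
qed

lemma three_in_ext_set: "3 \<in> ext_set 3 2 3"
  by (simp add: ext_set_def orth_sets_3_3_2_empty)

end

theory Submission
  imports Defs "Jordan_Normal_Form.Determinant" "HOL-Computational_Algebra.Primes"
begin

text \<open>
  If \<open>d\<close> vectors of norm \<open>\<surd>N\<close> in \<open>\<int>\<^sup>d\<close> are orthogonal, the determinant of the matrix with these
  rows has square \<open>N\<^sup>d\<close>; for odd \<open>d\<close> this makes \<open>N\<close> a square.

  Conversely, let \<open>N = n\<^sup>2\<close>, let \<open>v\<^sub>i\<close> be \<open>d - 1\<close> orthogonal vectors of norm \<open>n\<close> and let \<open>y\<close> be a nonzero
  integer vector orthogonal to all of them. The square of the determinant with rows \<open>v\<^sub>i\<close> and \<open>y\<close> is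
  \<open>N\<close> to the power \<open>d - 1\<close> times \<open>y \<bullet> y\<close>, so \<open>y \<bullet> y = r\<^sup>2\<close> for an integer \<open>r\<close>. The vector \<open>x = (n / r) y\<close>
  has norm \<open>n\<close>; it is integral because the columns of the matrix with rows \<open>v\<^sub>i\<close> and \<open>x\<close> also have
  norm \<open>n\<close>, so that each \<open>(x\<^sub>k)\<^sup>2\<close> is an integer.

  For \<open>d mod 4 = 1\<close>, Lagrange's four-square theorem and quaternion blocks give \<open>d - 1\<close> orthogonal
  vectors of norm \<open>\<surd>N\<close> for every \<open>N\<close>.
\<close>

subsection \<open>Lagrange's four-square theorem\<close>

definition sum_of_four_squares :: "int \<Rightarrow> bool" where
  "sum_of_four_squares n \<longleftrightarrow> (\<exists>a b c d. n = a\<^sup>2 + b\<^sup>2 + c\<^sup>2 + d\<^sup>2)"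

lemma sum_of_four_squaresI: "n = a\<^sup>2 + b\<^sup>2 + c\<^sup>2 + d\<^sup>2 \<Longrightarrow> sum_of_four_squares n"
  unfolding sum_of_four_squares_def by blast

text \<open>Multiplicativity of the quaternion norm: for x = a + bi + cj + dk and y = p + qi + rj +
  sk the four squared terms are the coordinates of y times the conjugate of x. If x and y agree
  modulo m and m divides the norm of x, all four are divisible by m.\<close>

lemma euler_four_squares:
  fixes a b c d p q r s :: int
  shows "(a\<^sup>2 + b\<^sup>2 + c\<^sup>2 + d\<^sup>2) * (p\<^sup>2 + q\<^sup>2 + r\<^sup>2 + s\<^sup>2) =
    (a*p + b*q + c*r + d*s)\<^sup>2 + (a*q - b*p + c*s - d*r)\<^sup>2 +
    (a*r - b*s - c*p + d*q)\<^sup>2 + (a*s + b*r - c*q - d*p)\<^sup>2"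
  by (simp add: power2_eq_square algebra_simps)

lemma sum_of_four_squares_mult:
  "sum_of_four_squares m \<Longrightarrow> sum_of_four_squares n \<Longrightarrow> sum_of_four_squares (m * n)"
  unfolding sum_of_four_squares_def using euler_four_squares by metis

lemma least_abs_residue:
  fixes m x :: int
  assumes "0 < m"
  obtains a t where "x = a + m * t" and "2 * \<bar>a\<bar> \<le> m"
proof (cases "2 * (x mod m) \<le> m")
  case True
  then show ?thesis
    using that[of "x mod m" "x div m"] assms by simp
next
  case False
  have "x = (x mod m - m) + m * (x div m + 1)"
    by (simp add: algebra_simps)
  moreover have "2 * \<bar>x mod m - m\<bar> \<le> m"
    using False pos_mod_bound[OF assms, of x] by (simp add: abs_of_neg)
  ultimately show ?thesis by (rule that)
qed

text \<open>Replacing each coordinate by its residue of least absolute value modulo \<open>m\<close>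
  gives a sum of four squares \<open>m * r\<close> with \<open>r\<close> at most \<open>m\<close>.
  In Euler's product for \<open>(m * p) * (m * r)\<close> every square is divisible by
  \<open>m\<^sup>2\<close>, and cancelling leaves \<open>r * p\<close>. The extreme values 0 and
  \<open>m\<close> of \<open>r\<close> would both make \<open>m\<close> divide
  \<open>p\<close>.\<close>

lemma four_squares_descent:
  fixes m p :: int
  assumes p: "prime p" and m: "1 < m" "m < p" and sum: "sum_of_four_squares (m * p)"
  obtains r where "0 < r" "r < m" "sum_of_four_squares (r * p)"
proof -
  obtain x1 x2 x3 x4 where x: "m * p = x1\<^sup>2 + x2\<^sup>2 + x3\<^sup>2 + x4\<^sup>2"
    using sum unfolding sum_of_four_squares_def by blast
  have m0: "0 < m" using m by simp
  obtain a1 t1 where 1: "x1 = a1 + m * t1" "2 * \<bar>a1\<bar> \<le> m" using least_abs_residue[OF m0] .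
  obtain a2 t2 where 2: "x2 = a2 + m * t2" "2 * \<bar>a2\<bar> \<le> m" using least_abs_residue[OF m0] .
  obtain a3 t3 where 3: "x3 = a3 + m * t3" "2 * \<bar>a3\<bar> \<le> m" using least_abs_residue[OF m0] .
  obtain a4 t4 where 4: "x4 = a4 + m * t4" "2 * \<bar>a4\<bar> \<le> m" using least_abs_residue[OF m0] .
  define A where "A = a1\<^sup>2 + a2\<^sup>2 + a3\<^sup>2 + a4\<^sup>2"
  \<comment> \<open>This is \<open>A\<close> divided by \<open>m\<close>, found without division by
    expanding the squares of a_i + m t_i in \<open>m * p\<close>.\<close>
  define r where "r = p - (2*a1*t1 + 2*a2*t2 + 2*a3*t3 + 2*a4*t4
    + m * (t1\<^sup>2 + t2\<^sup>2 + t3\<^sup>2 + t4\<^sup>2))"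
  have A: "A = m * r"
  proof -
    have "m * p = A + m * (p - r)"
      unfolding x A_def r_def 1(1) 2(1) 3(1) 4(1)
      by (simp add: power2_eq_square algebra_simps)
    then show ?thesis by (simp add: algebra_simps)
  qed
  have ndvd: "\<not> m dvd p"
  proof
    assume "m dvd p"
    then have "m = p \<or> m = 1" using p m0 prime_int_iff[of p] by (meson order_less_imp_le)
    then show False using m by simp
  qed
  have sq_le: "4 * a\<^sup>2 \<le> m\<^sup>2" if "2 * \<bar>a\<bar> \<le> m" for a :: int
  proof -
    have "\<bar>2 * a\<bar> \<le> \<bar>m\<bar>" using that m0 by simp
    then have "(2 * a)\<^sup>2 \<le> m\<^sup>2" by (rule abs_le_square_iff[THEN iffD1])
    then show ?thesis by (simp add: power_mult_distrib)
  qed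
  note le = sq_le[OF 1(2)] sq_le[OF 2(2)] sq_le[OF 3(2)] sq_le[OF 4(2)]
  have "m * r \<le> m * m" using le A A_def by (simp add: power2_eq_square)
  then have "r \<le> m" using m0 by simp
  have "0 \<le> m * r" using A unfolding A_def by (metis add_nonneg_nonneg zero_le_power2)
  then have "0 \<le> r" using m0 by (simp add: zero_le_mult_iff)
  have "r \<noteq> 0"
  proof
    assume "r = 0"
    then have "a1\<^sup>2 + a2\<^sup>2 + a3\<^sup>2 + a4\<^sup>2 = 0" using A A_def by simp
    then have "a1 = 0" "a2 = 0" "a3 = 0" "a4 = 0"
      using zero_le_power2[of a1] zero_le_power2[of a2] zero_le_power2[of a3] zero_le_power2[of a4]
      by (smt (verit) zero_eq_power2)+
    then have "p = m * (t1\<^sup>2 + t2\<^sup>2 + t3\<^sup>2 + t4\<^sup>2)"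
      using \<open>r = 0\<close> unfolding r_def by simp
    then show False using ndvd by simp
  qed
  \<comment> \<open>Equality makes all four bounds in \<open>le\<close> sharp, so each 2 a_i is
    \<open>m\<close> or \<open>-m\<close>. Then \<open>m\<close> divides both \<open>r\<close> and
    the bracket subtracted in \<open>r_def\<close>, whose sum is \<open>p\<close>.\<close>
  have "r \<noteq> m"
  proof
    assume "r = m"
    then have "a1\<^sup>2 + a2\<^sup>2 + a3\<^sup>2 + a4\<^sup>2 = m\<^sup>2"
      using A A_def by (simp add: power2_eq_square)
    then have "4 * a1\<^sup>2 = m\<^sup>2" "4 * a2\<^sup>2 = m\<^sup>2" "4 * a3\<^sup>2 = m\<^sup>2" "4 * a4\<^sup>2 = m\<^sup>2"
      using le by linarith+
    then have "(2*a1)\<^sup>2 = m\<^sup>2" "(2*a2)\<^sup>2 = m\<^sup>2" "(2*a3)\<^sup>2 = m\<^sup>2" "(2*a4)\<^sup>2 = m\<^sup>2"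
      by (simp_all add: power_mult_distrib)
    then have "2*a1 = m \<or> 2*a1 = -m" "2*a2 = m \<or> 2*a2 = -m"
      "2*a3 = m \<or> 2*a3 = -m" "2*a4 = m \<or> 2*a4 = -m"
      by (simp_all only: power2_eq_iff)
    then have "m dvd 2*a1*t1" "m dvd 2*a2*t2" "m dvd 2*a3*t3" "m dvd 2*a4*t4"
      by (metis dvd_refl dvd_minus_iff dvd_mult2)+
    then have "m dvd r + (2*a1*t1 + 2*a2*t2 + 2*a3*t3 + 2*a4*t4
        + m * (t1\<^sup>2 + t2\<^sup>2 + t3\<^sup>2 + t4\<^sup>2))"
      using \<open>r = m\<close> by (intro dvd_add) simp_all
    then show False using ndvd unfolding r_def by simp
  qed
  \<comment> \<open>\<open>m z\<^sub>i\<close> are the four numbers squared in Euler's identity for \<open>(m p) (m r)\<close>.\<close>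
  define z1 where "z1 = p - (a1*t1 + a2*t2 + a3*t3 + a4*t4 + m * (t1\<^sup>2 + t2\<^sup>2 + t3\<^sup>2 + t4\<^sup>2))"
  define z2 where "z2 = t1*a2 - t2*a1 + t3*a4 - t4*a3"
  define z3 where "z3 = t1*a3 - t2*a4 - t3*a1 + t4*a2"
  define z4 where "z4 = t1*a4 + t2*a3 - t3*a2 - t4*a1"
  have "x1*a1 + x2*a2 + x3*a3 + x4*a4 =
      m * p - m * (x1*t1 + x2*t2 + x3*t3 + x4*t4)"
    unfolding x 1(1) 2(1) 3(1) 4(1) by (simp add: power2_eq_square algebra_simps)
  also have "\<dots> = m * z1"
    unfolding z1_def 1(1) 2(1) 3(1) 4(1) by (simp add: power2_eq_square algebra_simps)
  finally have z1: "x1*a1 + x2*a2 + x3*a3 + x4*a4 = m * z1" .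
  have z2: "x1*a2 - x2*a1 + x3*a4 - x4*a3 = m * z2"
    unfolding z2_def 1(1) 2(1) 3(1) 4(1) by (simp add: algebra_simps)
  have z3: "x1*a3 - x2*a4 - x3*a1 + x4*a2 = m * z3"
    unfolding z3_def 1(1) 2(1) 3(1) 4(1) by (simp add: algebra_simps)
  have z4: "x1*a4 + x2*a3 - x3*a2 - x4*a1 = m * z4"
    unfolding z4_def 1(1) 2(1) 3(1) 4(1) by (simp add: algebra_simps)
  have "(m * p) * (m * r) = (m*z1)\<^sup>2 + (m*z2)\<^sup>2 + (m*z3)\<^sup>2 + (m*z4)\<^sup>2"
    unfolding x A[symmetric] A_def euler_four_squares z1 z2 z3 z4 ..
  then have "m\<^sup>2 * (r * p) = m\<^sup>2 * (z1\<^sup>2 + z2\<^sup>2 + z3\<^sup>2 + z4\<^sup>2)"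
    by (simp add: power2_eq_square algebra_simps)
  then have "r * p = z1\<^sup>2 + z2\<^sup>2 + z3\<^sup>2 + z4\<^sup>2" using m0 by simp
  then show thesis
    using that[of r] sum_of_four_squaresI \<open>0 \<le> r\<close> \<open>r \<noteq> 0\<close> \<open>r \<le> m\<close> \<open>r \<noteq> m\<close> by simp
qed

text \<open>A prime dividing (x - y)(x + y) divides one factor, and on this range both factors are
  smaller than \<open>p\<close> in absolute value.\<close>

lemma inj_on_square_mod_prime:
  fixes p k :: int
  assumes "prime p" and "2 * k < p"
  shows "inj_on (\<lambda>x. x\<^sup>2 mod p) {0..k}"
proof (rule inj_onI)
  fix x y assume xy: "x \<in> {0..k}" "y \<in> {0..k}" "x\<^sup>2 mod p = y\<^sup>2 mod p"
  then have "p dvd (x - y) * (x + y)"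
    by (simp add: mod_eq_dvd_iff power2_eq_square algebra_simps)
  then have "p dvd x - y \<or> p dvd x + y"
    using assms(1) by (simp add: prime_dvd_mult_iff)
  moreover have "x = y" if "p dvd x - y"
    using that xy assms zdvd_not_zless[of "x - y" p] zdvd_not_zless[of "y - x" p]
    by (smt (verit) atLeastAtMost_iff dvd_diff_commute)
  moreover have "x = y" if "p dvd x + y"
    using that xy assms zdvd_not_zless[of "x + y" p] by (smt (verit) atLeastAtMost_iff)
  ultimately show "x = y" by blast
qed

text \<open>Pigeonhole: with p = 2k + 1, the k + 1 residues of x^2 and the k + 1 residues of -1 -
  y^2 cannot be disjoint. So \<open>p\<close> divides x^2 + y^2 + 1, and as x and y are at most k <
  p/2, the cofactor is below \<open>p\<close>.\<close>

lemma prime_multiple_sum_of_four_squares: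
  fixes p :: int
  assumes p: "prime p" and odd: "odd p"
  obtains m where "0 < m" "m < p" "sum_of_four_squares (m * p)"
proof -
  obtain k where k: "p = 2 * k + 1" using odd by (rule oddE)
  have "1 < p" using p by (rule prime_gt_1_int)
  then have "0 < k" using k by simp
  let ?f = "\<lambda>x. x\<^sup>2 mod p" and ?g = "\<lambda>y. (- 1 - y\<^sup>2) mod p"
  have inj_f: "inj_on ?f {0..k}" using inj_on_square_mod_prime[OF p] k by simp
  have "?f x = ?f y" if "?g x = ?g y" for x y
    using that by (simp add: mod_eq_dvd_iff dvd_diff_commute)
  then have inj_g: "inj_on ?g {0..k}" using inj_f unfolding inj_on_def by blast
  have "?f ` {0..k} \<inter> ?g ` {0..k} \<noteq> {}"
  proof
    assume "?f ` {0..k} \<inter> ?g ` {0..k} = {}"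
    then have "card (?f ` {0..k} \<union> ?g ` {0..k}) = nat (k + 1) + nat (k + 1)"
      by (simp add: card_Un_disjoint card_image[OF inj_f] card_image[OF inj_g])
    moreover have "?f ` {0..k} \<union> ?g ` {0..k} \<subseteq> {0..<p}" using \<open>1 < p\<close> by auto
    then have "card (?f ` {0..k} \<union> ?g ` {0..k}) \<le> nat p"
      using card_mono[of "{0..<p}"] by fastforce
    ultimately show False using k \<open>0 < k\<close> by linarith
  qed
  then obtain x y where xy: "x \<in> {0..k}" "y \<in> {0..k}" "?f x = ?g y" by blast
  then have "p dvd x\<^sup>2 + y\<^sup>2 + 1" by (simp add: mod_eq_dvd_iff algebra_simps)
  then obtain m where m: "x\<^sup>2 + y\<^sup>2 + 1 = p * m" ..
  have "x\<^sup>2 \<le> k\<^sup>2" "y\<^sup>2 \<le> k\<^sup>2" using xy by (simp_all add: power_mono)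
  moreover have "0 \<le> x\<^sup>2" "0 \<le> y\<^sup>2" by simp_all
  moreover have "2 * k\<^sup>2 + 1 < p * p" using \<open>0 < k\<close> unfolding k
    by (simp add: algebra_simps power2_eq_square add_pos_pos)
  ultimately have "0 < p * m" "p * m < p * p" using m by linarith+
  then have "0 < m" "m < p" using \<open>1 < p\<close> by (simp_all add: zero_less_mult_iff)
  moreover have "sum_of_four_squares (m * p)"
    by (rule sum_of_four_squaresI[of _ x y 1 0]) (simp add: m mult.commute)
  ultimately show thesis by (rule that)
qed

lemma prime_sum_of_four_squares:
  fixes p :: int
  assumes p: "prime p"
  shows "sum_of_four_squares p"
proof (cases "odd p")
  case False
  then have "p = 2" using p prime_odd_int by (metis prime_ge_2_int order_le_less)
  then show ?thesis using sum_of_four_squaresI[of p 1 1 0 0] by simp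
next
  case True
  have "sum_of_four_squares p" if "0 < m" "m < p" "sum_of_four_squares (m * p)" for m
    using that
  proof (induction "nat m" arbitrary: m rule: less_induct)
    case less
    show ?case
    proof (cases "m = 1")
      case False
      then obtain r where "0 < r" "r < m" "sum_of_four_squares (r * p)"
        using four_squares_descent[OF p, of m] less.prems by auto
      then show ?thesis using less by simp
    qed (use less.prems in simp)
  qed
  then show ?thesis using prime_multiple_sum_of_four_squares[OF p True] by blast
qed

lemma lagrange_four_squares: "sum_of_four_squares (int n)"
proof (induction n rule: prime_divisors_induct)
  case zero
  show ?case using sum_of_four_squaresI[of 0 0 0 0 0] by simp
next
  case (unit n)
  then show ?case using sum_of_four_squaresI[of 1 1 0 0 0] by simp
next
  case (factor p n)
  then show ?case
    using sum_of_four_squares_mult prime_sum_of_four_squares[of "int p"] by simp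
qed

subsection \<open>Orthogonal sets of integer vectors\<close>

text \<open>Trades sets of vectors for indexed families of coordinate functions whose Gram matrix is
  \<open>N\<close> times the identity. Such families are the rows of a matrix, and a row is added by
  a function update.\<close>

lemma orth_sets_iff:
  assumes "0 < N"
  shows "S \<in> orth_sets d N m \<longleftrightarrow>
    (\<exists>c. S = (\<lambda>i. vec d (c i)) ` {..<m} \<and>
      (\<forall>i<m. \<forall>j<m. (\<Sum>k = 0..<d. c i k * c j k) = (if i = j then int N else 0)))"
    (is "_ \<longleftrightarrow> (\<exists>c. ?P c)")
proof
  assume "S \<in> orth_sets d N m"
  then have S: "S \<subseteq> carrier_vec d" "finite S" "card S = m"
    and orth: "\<And>v w. v \<in> S \<Longrightarrow> w \<in> S \<Longrightarrow> v \<noteq> w \<Longrightarrow> v \<bullet> w = 0"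
    and norm: "\<And>v. v \<in> S \<Longrightarrow> enorm v = sqrt (real N)"
    by (auto simp: orth_sets_def pairwise_def)
  have norm': "v \<bullet> v = int N" if "v \<in> S" for v
  proof -
    have "real_of_int (v \<bullet> v) = real_of_int (int N)"
      using norm[OF that] by (simp add: enorm_def)
    then show ?thesis by (simp only: of_int_eq_iff)
  qed
  obtain f where f: "bij_betw f {..<m} S"
    using ex_bij_betw_nat_finite[OF S(2)] S(3) by (auto simp: atLeast0LessThan)
  then have fS: "f i \<in> S" if "i < m" for i
    using that by (auto simp: bij_betw_def)
  then have dim: "dim_vec (f i) = d" if "i < m" for i
    using fS[OF that] S(1) by (meson carrier_vecD subsetD)
  have "S = f ` {..<m}" using f by (simp add: bij_betw_def)
  also have "\<dots> = (\<lambda>i. vec d (\<lambda>k. f i $ k)) ` {..<m}"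
    using dim by (intro image_cong) auto
  finally have "S = \<dots>" .
  moreover have "(\<Sum>k = 0..<d. f i $ k * f j $ k) = (if i = j then int N else 0)"
    if "i < m" "j < m" for i j
  proof -
    have "(\<Sum>k = 0..<d. f i $ k * f j $ k) = f i \<bullet> f j"
      using dim[OF that(2)] by (simp add: scalar_prod_def)
    also have "\<dots> = (if i = j then int N else 0)"
    proof (cases "i = j")
      case False
      then have "f i \<noteq> f j" using f that by (auto simp: bij_betw_def inj_on_eq_iff)
      then show ?thesis using orth[OF fS fS] that False by simp
    qed (use that fS norm' in simp)
    finally show ?thesis .
  qed
  ultimately show "\<exists>c. ?P c" by (intro exI[of _ "\<lambda>i k. f i $ k"]) blast
next
  assume "\<exists>c. ?P c"
  then obtain c where S: "S = (\<lambda>i. vec d (c i)) ` {..<m}"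
    and c: "\<And>i j. i < m \<Longrightarrow> j < m \<Longrightarrow>
      (\<Sum>k = 0..<d. c i k * c j k) = (if i = j then int N else 0)"
    by blast
  have sp: "vec d (c i) \<bullet> vec d (c j) = (if i = j then int N else 0)"
    if "i < m" "j < m" for i j
    using c[OF that] by (simp add: scalar_prod_def)
  \<comment> \<open>Equal vectors at distinct indices would have inner product both \<open>N\<close>
    and 0, which is where positivity of \<open>N\<close> enters.\<close>
  have "inj_on (\<lambda>i. vec d (c i)) {..<m}"
    by (rule inj_onI) (use sp assms in \<open>metis lessThan_iff of_nat_0_eq_iff less_irrefl\<close>)
  then have "card S = m" unfolding S by (simp add: card_image)
  moreover have "pairwise (\<lambda>v w. v \<bullet> w = 0) S"
    unfolding S pairwise_def using sp by auto
  ultimately show "S \<in> orth_sets d N m"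
    unfolding orth_sets_def using sp by (auto simp: S enorm_def)
qed

section \<open>Matrices with orthogonal rows, and integer kernel vectors\<close>

lemma det_square_orthogonal_rows:
  fixes c :: "nat \<Rightarrow> nat \<Rightarrow> 'a :: comm_ring_1"
  assumes c: "\<And>i j. i < n \<Longrightarrow> j < n \<Longrightarrow>
    (\<Sum>k = 0..<n. c i k * c j k) = (if i = j then e i else 0)"
  shows "(det (mat n n (\<lambda>(i, j). c i j)))\<^sup>2 = (\<Prod>i = 0..<n. e i)"
proof -
  define A where "A = mat n n (\<lambda>(i, j). c i j)"
  define D where "D = mat n n (\<lambda>(i, j). if i = j then e i else 0)"
  have A: "A \<in> carrier_mat n n" by (simp add: A_def)
  \<comment> \<open>The Gram matrix of the rows is diagonal. Its entries may differ, as the added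
    row \<open>y\<close> will have a norm of its own.\<close>
  have "A * transpose_mat A = D"
    by (rule eq_matI) (simp_all add: A_def D_def scalar_prod_def c)
  then have "(det A)\<^sup>2 = det D"
    using det_mult[OF A, of "transpose_mat A"] det_transpose[OF A] A
    by (simp add: power2_eq_square)
  also have "det D = prod_list (diag_mat D)"
    by (rule det_upper_triangular[of _ n]) (auto simp: D_def)
  also have "diag_mat D = map e [0..<n]"
    by (auto simp: diag_mat_def D_def)
  also have "prod_list (map e [0..<n]) = (\<Prod>i = 0..<n. e i)"
    by (simp add: prod.distinct_set_conv_list[symmetric])
  finally show ?thesis by (simp add: A_def)
qed

text \<open>The transpose divided by \<open>s\<close> is a right inverse of the matrix, hence a left
  inverse too; the entries of that second product are the inner products of columns. The computation
  runs over the rationals so that \<open>s\<close> is invertible.\<close>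

lemma orthogonal_columns:
  fixes c :: "nat \<Rightarrow> nat \<Rightarrow> int"
  assumes c: "\<And>i j. i < n \<Longrightarrow> j < n \<Longrightarrow>
      (\<Sum>k = 0..<n. c i k * c j k) = (if i = j then s else 0)"
    and "s \<noteq> 0" "i < n" "j < n"
  shows "(\<Sum>k = 0..<n. c k i * c k j) = (if i = j then s else 0)"
proof -
  define A where "A = mat n n (\<lambda>(i, j). rat_of_int (c i j))"
  define B where "B = mat n n (\<lambda>(i, j). rat_of_int (c j i) / of_int s)"
  have "A * B = 1\<^sub>m n"
  proof (rule eq_matI)
    fix i j assume "i < dim_row (1\<^sub>m n :: rat mat)" "j < dim_col (1\<^sub>m n :: rat mat)"
    then have ij: "i < n" "j < n" by simp_all
    have "(A * B) $$ (i, j) = (\<Sum>k = 0..<n. of_int (c i k * c j k) / of_int s)"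
      using ij by (simp add: A_def B_def scalar_prod_def)
    also have "\<dots> = of_int (\<Sum>k = 0..<n. c i k * c j k) / of_int s"
      by (simp add: sum_divide_distrib)
    finally show "(A * B) $$ (i, j) = 1\<^sub>m n $$ (i, j)"
      using ij \<open>s \<noteq> 0\<close> by (simp add: c)
  qed (simp_all add: A_def B_def)
  then have "B * A = 1\<^sub>m n"
    by (rule mat_mult_left_right_inverse[rotated 2]) (simp_all add: A_def B_def)
  then have "(B * A) $$ (i, j) = (if i = j then 1 else 0)"
    using assms by simp
  moreover have "(B * A) $$ (i, j) = (\<Sum>k = 0..<n. of_int (c k i * c k j) / of_int s)"
    using assms by (simp add: A_def B_def scalar_prod_def)
  moreover have "\<dots> = of_int (\<Sum>k = 0..<n. c k i * c k j) / of_int s"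
    by (simp add: sum_divide_distrib)
  ultimately have "rat_of_int (\<Sum>k = 0..<n. c k i * c k j) = of_int (if i = j then s else 0)"
    using \<open>s \<noteq> 0\<close> by (simp add: field_simps split: if_splits)
  then show ?thesis by (simp only: of_int_eq_iff)
qed

text \<open>The \<open>m\<close> rows, padded by a zero row, form a singular square integer matrix;
  a nonzero integer kernel vector is the required \<open>y\<close>.\<close>

lemma ex_orthogonal_vector:
  fixes c :: "nat \<Rightarrow> nat \<Rightarrow> int"
  obtains y where "\<And>i. i < m \<Longrightarrow> (\<Sum>k = 0..<Suc m. c i k * y k) = 0"
    and "0 < (\<Sum>k = 0..<Suc m. y k * y k)"
proof -
  define A where "A = mat (Suc m) (Suc m) (\<lambda>(i, j). if i < m then c i j else 0)"
  have A: "A \<in> carrier_mat (Suc m) (Suc m)" by (simp add: A_def)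
  \<comment> \<open>The zero row is the last column of the transpose, so the last unit vector
    witnesses singularity.\<close>
  have "transpose_mat A *\<^sub>v unit_vec (Suc m) m = 0\<^sub>v (Suc m)"
    by (rule eq_vecI) (simp_all add: A_def)
  then have "det (transpose_mat A) = 0"
    using det_0_iff_vec_prod_zero[of "transpose_mat A" "Suc m"] A unit_vec_nonzero[of m "Suc m"]
    by (metis lessI transpose_carrier_mat unit_vec_carrier)
  then have "det A = 0" using det_transpose[OF A] by simp
  then obtain v where v: "v \<in> carrier_vec (Suc m)" "v \<noteq> 0\<^sub>v (Suc m)" "A *\<^sub>v v = 0\<^sub>v (Suc m)"
    using det_0_iff_vec_prod_zero[OF A] by blast
  show thesis
  proof (rule that[of "\<lambda>k. v $ k"])
    fix i assume "i < m"
    then have "(A *\<^sub>v v) $ i = (\<Sum>k = 0..<Suc m. c i k * v $ k)"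
      using v(1) by (simp add: A_def scalar_prod_def)
    then show "(\<Sum>k = 0..<Suc m. c i k * v $ k) = 0"
      using v(3) \<open>i < m\<close> by simp
  next
    obtain k where "k < Suc m" "v $ k \<noteq> 0"
      using v(1,2) by (metis carrier_vecD eq_vecI index_zero_vec(1,2))
    then show "0 < (\<Sum>k = 0..<Suc m. v $ k * v $ k)"
      by (intro sum_pos2[of _ k]) (auto simp: zero_less_mult_iff not_less)
  qed
qed

lemma square_factor_dvd:
  fixes a b x :: int
  assumes "a\<^sup>2 = b\<^sup>2 * x" and "b \<noteq> 0"
  obtains r where "x = r\<^sup>2"
proof -
  have "b dvd a" using assms(1) by (metis dvd_triv_left pow_divides_pow_iff pos2)
  then obtain r where "a = b * r" ..
  then show thesis using assms that[of r] by (simp add: power_mult_distrib)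
qed

section \<open>Adding the last vector, and the square criterion\<close>

lemma orth_sets_extend_square:
  assumes "0 < n" and S: "S \<in> orth_sets (Suc m) (n\<^sup>2) m"
  obtains S' where "S' \<in> orth_sets (Suc m) (n\<^sup>2) (Suc m)" and "S \<subseteq> S'"
proof -
  let ?d = "Suc m"
  have pos: "0 < n\<^sup>2" using assms(1) by simp
  obtain c where Sc: "S = (\<lambda>i. vec ?d (c i)) ` {..<m}"
    and c: "\<And>i j. i < m \<Longrightarrow> j < m \<Longrightarrow>
      (\<Sum>k = 0..<?d. c i k * c j k) = (if i = j then int (n\<^sup>2) else 0)"
    using S unfolding orth_sets_iff[OF pos] by blast
  obtain y where y: "\<And>i. i < m \<Longrightarrow> (\<Sum>k = 0..<?d. c i k * y k) = 0"
    and y_pos: "0 < (\<Sum>k = 0..<?d. y k * y k)"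
    using ex_orthogonal_vector[of m c] by blast
  have y': "(\<Sum>k = 0..<?d. y k * c i k) = 0" if "i < m" for i
    using y[OF that] by (simp only: mult.commute)
  define Y where "Y = (\<Sum>k = 0..<?d. y k * y k)"
  note sum.op_ivl_Suc [simp del]
  have "(det (mat ?d ?d (\<lambda>(i, j). (c(m := y)) i j)))\<^sup>2 =
      (\<Prod>i = 0..<?d. if i < m then int (n\<^sup>2) else Y)"
    by (rule det_square_orthogonal_rows) (auto simp: c y y' Y_def less_Suc_eq)
  also have "\<dots> = (int n ^ m)\<^sup>2 * Y"
    by (simp add: power_mult [symmetric] mult.commute)
  finally obtain r where r: "Y = r\<^sup>2"
    using square_factor_dvd assms(1) by (metis of_nat_0_less_iff power_not_zero less_irrefl)
  then have "r \<noteq> 0" using y_pos Y_def by auto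
  \<comment> \<open>This is \<open>r\<close> times the matrix with rows v_i and (n / r) y, so all
    rows have norm r n while the entries stay integral.\<close>
  define C where "C = (\<lambda>i k. if i < m then r * c i k else int n * y k)"
  have sc: "(\<Sum>k = 0..<?d. (a * f k) * (b * g k)) = a * b * (\<Sum>k = 0..<?d. f k * g k)"
    for a b :: int and f g
    by (simp add: sum_distrib_left mult.assoc mult.left_commute)
  have C: "(\<Sum>k = 0..<?d. C i k * C j k) = (if i = j then (r * int n)\<^sup>2 else 0)"
    if "i < ?d" "j < ?d" for i j
    using that Y_def[symmetric] r
    by (auto simp: C_def sc c y y' less_Suc_eq power_mult_distrib power2_eq_square)
  \<comment> \<open>Column \<open>k\<close> of \<open>C\<close> also has squared norm (r n)^2, and
    its first \<open>m\<close> entries are multiples of \<open>r\<close>. Hence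
    \<open>r\<^sup>2\<close> divides the square of the remaining entry.\<close>
  have "r dvd int n * y k" if k: "k < ?d" for k
  proof -
    have "(r * int n)\<^sup>2 = (\<Sum>i = 0..<?d. C i k * C i k)"
      using orthogonal_columns[OF C _ k k] \<open>r \<noteq> 0\<close> assms(1) by simp
    also have "\<dots> = (\<Sum>i = 0..<m. r\<^sup>2 * (c i k)\<^sup>2) + (int n * y k)\<^sup>2"
      by (simp add: C_def sum.op_ivl_Suc power2_eq_square mult.assoc mult.left_commute)
    finally have "(int n * y k)\<^sup>2 = r\<^sup>2 * ((int n)\<^sup>2 - (\<Sum>i = 0..<m. (c i k)\<^sup>2))"
      by (simp add: sum_distrib_left right_diff_distrib power_mult_distrib)
    then have "r\<^sup>2 dvd (int n * y k)\<^sup>2" by simp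
    then show ?thesis by simp
  qed
  then have "\<exists>x. \<forall>k<?d. int n * y k = r * x k" unfolding dvd_def by metis
  then obtain x where x: "\<And>k. k < ?d \<Longrightarrow> int n * y k = r * x k" by blast
  \<comment> \<open>Inner products with \<open>x\<close> follow from those with \<open>y\<close> by
    cancelling \<open>r\<close>; for \<open>x\<close> with itself this is applied twice.\<close>
  have rx: "r * (\<Sum>k = 0..<?d. f k * x k) = int n * (\<Sum>k = 0..<?d. f k * y k)" for f
    unfolding sum_distrib_left by (rule sum.cong) (use x in \<open>auto simp: mult.left_commute\<close>)
  have cx: "(\<Sum>k = 0..<?d. c i k * x k) = 0" if "i < m" for i
    using rx[of "c i"] y[OF that] \<open>r \<noteq> 0\<close> by simp
  then have cx': "(\<Sum>k = 0..<?d. x k * c i k) = 0" if "i < m" for i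
    using that by (simp only: mult.commute)
  have "r * (r * (\<Sum>k = 0..<?d. x k * x k)) = int n * (r * (\<Sum>k = 0..<?d. y k * x k))"
    unfolding rx[of x] by (simp add: mult.commute mult.left_commute)
  also have "\<dots> = r * (r * int (n\<^sup>2))"
    unfolding rx[of y] Y_def[symmetric] r by (simp add: power2_eq_square)
  finally have xx: "(\<Sum>k = 0..<?d. x k * x k) = int (n\<^sup>2)" using \<open>r \<noteq> 0\<close> by simp
  show thesis
  proof (rule that)
    show "(\<lambda>i. vec ?d ((c(m := x)) i)) ` {..<?d} \<in> orth_sets ?d (n\<^sup>2) ?d"
      unfolding orth_sets_iff[OF pos]
      by (rule exI[of _ "c(m := x)"]) (auto simp: c cx cx' xx less_Suc_eq)
    show "S \<subseteq> (\<lambda>i. vec ?d ((c(m := x)) i)) ` {..<?d}"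
      unfolding Sc by force
  qed
qed

lemma orth_sets_full_odd_square:
  assumes "0 < N" and "odd d" and S: "S \<in> orth_sets d N d"
  obtains n where "0 < n" and "N = n\<^sup>2"
proof -
  obtain c where c: "\<And>i j. i < d \<Longrightarrow> j < d \<Longrightarrow>
      (\<Sum>k = 0..<d. c i k * c j k) = (if i = j then int N else 0)"
    using S unfolding orth_sets_iff[OF \<open>0 < N\<close>] by blast
  obtain k where k: "d = 2 * k + 1" using \<open>odd d\<close> by (rule oddE)
  have "(det (mat d d (\<lambda>(i, j). c i j)))\<^sup>2 = int N ^ d"
    using det_square_orthogonal_rows[of d c "\<lambda>_. int N"] c by simp
  also have "\<dots> = (int N ^ k)\<^sup>2 * int N"
    by (simp add: k power_mult power2_eq_square power_mult_distrib)
  finally obtain r where r: "int N = r\<^sup>2"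
    using square_factor_dvd \<open>0 < N\<close> by (metis of_nat_0_less_iff power_not_zero less_irrefl)
  then have "N = (nat \<bar>r\<bar>)\<^sup>2" by (metis nat_int nat_power_eq abs_ge_zero power2_abs)
  then show thesis using that[of "nat \<bar>r\<bar>"] \<open>0 < N\<close> by (cases "r = 0") auto
qed

section \<open>Existence of orthogonal sets\<close>

lemma orth_sets_square_nonempty:
  assumes "0 < n" and "m \<le> d"
  shows "orth_sets d (n\<^sup>2) m \<noteq> {}"
proof -
  \<comment> \<open>The first \<open>m\<close> unit vectors, scaled by \<open>n\<close>.\<close>
  let ?c = "\<lambda>i k. if k = i then int n else 0"
  have "(\<Sum>k = 0..<d. ?c i k * ?c j k) = (if i = j then int (n\<^sup>2) else 0)"
    if "i < m" for i j
  proof -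
    have "(\<Sum>k = 0..<d. ?c i k * ?c j k) =
        (\<Sum>k = 0..<d. if k = i then int n * ?c j i else 0)"
      by (intro sum.cong) auto
    also have "\<dots> = int n * ?c j i" using that assms(2) by simp
    finally show ?thesis by (simp add: power2_eq_square)
  qed
  then have "(\<lambda>i. vec d (?c i)) ` {..<m} \<in> orth_sets d (n\<^sup>2) m"
    using assms(1) by (subst orth_sets_iff) (auto intro!: exI[of _ ?c])
  then show ?thesis by blast
qed

lemma orth_sets_four_squares_nonempty:
  assumes "0 < N" and "4 * l \<le> d"
  shows "orth_sets d N (4 * l) \<noteq> {}"
proof -
  obtain a b c e where abce: "int N = a\<^sup>2 + b\<^sup>2 + c\<^sup>2 + e\<^sup>2"
    using lagrange_four_squares unfolding sum_of_four_squares_def by blast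
  \<comment> \<open>For h = a + bi + cj + ek the rows are the coordinates of h, ih, jh and
    kh.\<close>
  define Q where
    "Q = (\<lambda>i j. [[a, b, c, e], [- b, a, - e, c], [- c, e, a, - b], [- e, - c, b, a]] ! i ! j)"
  have less4: "i = 0 \<or> i = 1 \<or> i = 2 \<or> i = 3" if "i < 4" for i :: nat
    using that by linarith
  have Q: "(\<Sum>k<4. Q i k * Q j k) = (if i = j then int N else 0)" if "i < 4" "j < 4" for i j
    using less4[OF that(1)] less4[OF that(2)] unfolding Q_def abce
    by (elim disjE; simp add: numeral_eq_Suc power2_eq_square)
  \<comment> \<open>Row \<open>i\<close> is row \<open>i mod 4\<close> of \<open>Q\<close> placed in
    block \<open>i div 4\<close>. For \<open>i < 4 * l\<close> the coordinates from
    \<open>4 * l\<close> on are zero.\<close>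
  define v where "v = (\<lambda>i k. if k div 4 = i div 4 then Q (i mod 4) (k mod 4) else 0)"
  have "(\<Sum>k = 0..<d. v i k * v j k) = (if i = j then int N else 0)"
    if i: "i < 4 * l" for i j
  proof (cases "i div 4 = j div 4")
    case False
    then have "v i k * v j k = 0" for k by (simp add: v_def)
    then have "(\<Sum>k = 0..<d. v i k * v j k) = 0" by (simp only: sum.neutral_const)
    then show ?thesis using False by auto
  next
    case True
    define q where "q = i div 4"
    have "q < l" using i by (simp add: q_def)
    then have q: "4 * q + 4 \<le> d" using assms(2) by linarith
    have "(\<Sum>k = 0..<d. v i k * v j k) = (\<Sum>k = 4 * q..<4 * q + 4. v i k * v j k)"
      by (rule sum.mono_neutral_right) (use q in \<open>auto simp: v_def q_def[symmetric]\<close>)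
    also have "\<dots> = (\<Sum>k<4. v i (4 * q + k) * v j (4 * q + k))"
      using sum.shift_bounds_nat_ivl[of "\<lambda>k. v i k * v j k" 0 "4 * q" 4]
      by (simp add: atLeast0LessThan add.commute)
    also have "\<dots> = (\<Sum>k<4. Q (i mod 4) k * Q (j mod 4) k)"
      by (rule sum.cong) (use True in \<open>auto simp: v_def q_def\<close>)
    also have "\<dots> = (if i mod 4 = j mod 4 then int N else 0)"
      by (rule Q) simp_all
    also have "i mod 4 = j mod 4 \<longleftrightarrow> i = j"
      using True by (metis div_mult_mod_eq)
    finally show ?thesis .
  qed
  then have "(\<lambda>i. vec d (v i)) ` {..<4 * l} \<in> orth_sets d N (4 * l)"
    unfolding orth_sets_iff[OF assms(1)] by (intro exI[of _ v]) simp
  then show ?thesis by blast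
qed

theorem corollary2p6:
  fixes d :: nat
  assumes "odd d" and "1 \<le> d - 1"
  shows "{N \<in> ext_set d (d - 1) d. orth_sets d N (d - 1) \<noteq> {}} = {n\<^sup>2 | n::nat. 0 < n} \<and>
         (d mod 4 = 1 \<longrightarrow> ext_set d (d - 1) d = {n\<^sup>2 | n::nat. 0 < n})"
proof -
  have d: "d = Suc (d - 1)" using assms(2) by simp
  have nonempty: "{N \<in> ext_set d (d - 1) d. orth_sets d N (d - 1) \<noteq> {}} = {n\<^sup>2 | n::nat. 0 < n}"
  proof (intro equalityI subsetI)
    fix N assume "N \<in> {N \<in> ext_set d (d - 1) d. orth_sets d N (d - 1) \<noteq> {}}"
    then obtain S where "0 < N" "S \<in> orth_sets d N d"
      unfolding ext_set_def by blast
    then obtain n where "0 < n" "N = n\<^sup>2"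
      using orth_sets_full_odd_square[of N d S] assms(1) by blast
    then show "N \<in> {n\<^sup>2 | n. 0 < n}" by blast
  next
    fix N :: nat assume "N \<in> {n\<^sup>2 | n. 0 < n}"
    then obtain n where n: "0 < n" "N = n\<^sup>2" by blast
    have "\<exists>S'\<in>orth_sets d N d. S \<subseteq> S'" if "S \<in> orth_sets d N (d - 1)" for S
      using orth_sets_extend_square[of n S "d - 1"] that n d by metis
    then have "N \<in> ext_set d (d - 1) d"
      using n by (simp add: ext_set_def)
    then show "N \<in> {N \<in> ext_set d (d - 1) d. orth_sets d N (d - 1) \<noteq> {}}"
      using orth_sets_square_nonempty[OF n(1), of "d - 1" d] n(2) by simp
  qed
  \<comment> \<open>Here d - 1 is a multiple of 4, so the quaternion blocks supply all d - 1 vectors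
    and no membership is vacuous.\<close>
  moreover have "orth_sets d N (d - 1) \<noteq> {}" if "d mod 4 = 1" "N \<in> ext_set d (d - 1) d" for N
  proof -
    have "d - 1 = 4 * (d div 4)" using that(1) by presburger
    then show ?thesis
      using orth_sets_four_squares_nonempty[of N "d div 4" d] that(2) by (simp add: ext_set_def)
  qed
  ultimately show ?thesis by blast
qed

end
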